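(* Let $T$ be a rooted homogeneous tree of order $\gamma$. If $B$ is the backward shift on $\mathcal{L}_0$, then $$\sigma_{\mathrm{p}}(B)=\{\lambda\in\mathbb{C}:|\lambda|<\gamma\}\cup\{\gamma\}.$$
   Context: A tree is an undirected graph (no loops or multiple edges) in which any two vertices are joined by exactly one path; $T$ also denotes its vertex set, which is assumed countably infinite, and every vertex has finite degree. $T$ has a distinguished vertex $o$, the root; $|v|$ is the length (number of edges) of the path from $o$ to $v$. For $v\neq o$, the parent $\mathrm{par}(v)$ is the vertex preceding $v$ on the unique path from $o$ to $v$; $\mathrm{Chi}(v)$ is the set of children of $v$ (vertices with parent $v$), and $\gamma(v)$ is its cardinality. $T$ is homogeneous of order $\gamma$ if $\gamma(v)=\gamma$ for all $v\in T$ (so $\gamma\geq 1$). For $f:T\to\mathbb{C}$ define $f'(o)=f(o)$ and $f'(v)=f(v)-f(\mathrm{par}(v))$ for $v\neq o$. The little Lipschitz space $\mathcal{L}_0$ is the Banach space of all $f:T\to\mathbb{C}$ with $\lim_{|v|\to\infty}f'(v)=0$, with norm $\|f\|=\sup_{v\in T}|f'(v)|$. The backward shift is $(Bf)(v)=\sum_{w\in\mathrm{Chi}(v)}f(w)$; it is bounded on $\mathcal{L}_0$ for homogeneous $T$. $\sigma_{\mathrm{p}}$ denotes the set of eigenvalues. *)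

theory Defs
  imports Complex_Main "HOL-Library.Countable_Set"
begin

definition is_path :: "('v \<Rightarrow> 'v \<Rightarrow> bool) \<Rightarrow> 'v \<Rightarrow> 'v list \<Rightarrow> 'v \<Rightarrow> bool" where
  "is_path adj u p v \<longleftrightarrow>
     p \<noteq> [] \<and> hd p = u \<and> last p = v \<and> distinct p \<and> successively adj p"

text \<open>The vertex set of the tree is the whole type \<open>'v\<close>, so functions on the tree are
  functions on the type and no extensionality convention is needed.\<close>

locale tree =
  fixes adj :: "'v \<Rightarrow> 'v \<Rightarrow> bool"
  assumes adj_sym: "adj u v \<Longrightarrow> adj v u"
    and adj_irrefl: "\<not> adj v v"
    and unique_path: "\<exists>!p. is_path adj u p v"
    and countable_vertices: "countable (UNIV :: 'v set)"
    and infinite_vertices: "infinite (UNIV :: 'v set)"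
    and finite_degree: "finite {w. adj v w}"
begin

context
  fixes root :: 'v
begin

definition root_path :: "'v \<Rightarrow> 'v list" where
  "root_path v = (THE p. is_path adj root p v)"

definition depth :: "'v \<Rightarrow> nat" where
  "depth v = length (root_path v) - 1"

text \<open>Meaningful only for \<open>v \<noteq> root\<close>.\<close>

definition parent :: "'v \<Rightarrow> 'v" where
  "parent v = last (butlast (root_path v))"

definition children :: "'v \<Rightarrow> 'v set" where
  "children v = {w. w \<noteq> root \<and> parent w = v}"

definition homogeneous :: "nat \<Rightarrow> bool" where
  "homogeneous \<gamma> \<longleftrightarrow> (\<forall>v. card (children v) = \<gamma>)"

definition tree_deriv :: "('v \<Rightarrow> complex) \<Rightarrow> 'v \<Rightarrow> complex" where
  "tree_deriv f v = (if v = root then f root else f v - f (parent v))"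

text \<open>The filter \<open>filtercomap depth at_top\<close> expresses that the depth tends to infinity.\<close>

definition little_lipschitz :: "('v \<Rightarrow> complex) set" where
  "little_lipschitz = {f. (tree_deriv f \<longlongrightarrow> 0) (filtercomap depth at_top)}"

definition lipschitz_norm :: "('v \<Rightarrow> complex) \<Rightarrow> real" where
  "lipschitz_norm f = (SUP v. norm (tree_deriv f v))"

definition backward_shift :: "('v \<Rightarrow> complex) \<Rightarrow> 'v \<Rightarrow> complex" where
  "backward_shift f v = (\<Sum>w\<in>children v. f w)"

text \<open>For a homogeneous tree, the backward shift maps the little Lipschitz space into itself and is
  bounded there; the factor \<open>3 * \<gamma>\<close> below is not claimed to be optimal.\<close>

lemma root_path: "is_path adj root (root_path v) v"
  unfolding root_path_def by (rule theI') (rule unique_path)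

lemma root_path_eqI: "is_path adj root p v \<Longrightarrow> root_path v = p"
  using root_path[of v] unique_path[of root v] by auto

lemma root_path_parent:
  assumes "v \<noteq> root"
  shows "root_path v = root_path (parent v) @ [v]" "adj (parent v) v"
proof -
  define p where "p = root_path v"
  define q where "q = butlast p"
  have p: "p \<noteq> []" "hd p = root" "last p = v" "distinct p" "successively adj p"
    using root_path[of v] by (auto simp: is_path_def p_def)
  have pq: "p = q @ [v]" using p unfolding q_def by (metis append_butlast_last_id)
  have "q \<noteq> []" using p assms pq by auto
  moreover have "successively adj q" and adj: "adj (last q) v"
    using p(5) \<open>q \<noteq> []\<close> unfolding pq by (auto simp: successively_append_iff)
  ultimately have "is_path adj root q (last q)"
    using p unfolding is_path_def pq by auto
  then have "root_path (last q) = q" by (rule root_path_eqI)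
  moreover have "parent v = last q" by (simp add: parent_def q_def p_def)
  ultimately show "root_path v = root_path (parent v) @ [v]" "adj (parent v) v"
    using pq adj by (auto simp: p_def)
qed

lemma depth_parent: "v \<noteq> root \<Longrightarrow> depth v = Suc (depth (parent v))"
  using root_path[of "parent v"] root_path_parent(1)[of v]
  by (cases "root_path (parent v)") (auto simp: depth_def is_path_def)

lemma finite_children: "finite (children v)"
proof (rule finite_subset[OF _ finite_degree[of v]])
  show "children v \<subseteq> {w. adj v w}"
    using root_path_parent(2) unfolding children_def by blast
qed

lemma finite_depth_le: "finite {v. depth v \<le> n}"
proof (induction n)
  case 0
  have "v = root" if "depth v \<le> 0" for v using that depth_parent[of v] by auto
  then have "{v. depth v \<le> 0} \<subseteq> {root}" by blast
  then show ?case by (rule finite_subset) simp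
next
  case (Suc n)
  have "v = root \<or> depth (parent v) \<le> n \<and> v \<in> children (parent v)"
    if "depth v \<le> Suc n" for v
    using that depth_parent[of v] by (auto simp: children_def)
  then have "{v. depth v \<le> Suc n} \<subseteq> {root} \<union> (\<Union>u\<in>{v. depth v \<le> n}. children u)"
    by blast
  then show ?case
    by (rule finite_subset) (use Suc finite_children in auto)
qed

lemma little_lipschitz_iff:
  "f \<in> little_lipschitz \<longleftrightarrow>
     (\<forall>e>0. \<exists>n. \<forall>v. depth v \<ge> n \<longrightarrow> norm (tree_deriv f v) < e)"
  unfolding little_lipschitz_def tendsto_iff eventually_filtercomap_at_top_linorder
  by (simp add: dist_norm)

lemma bdd_above_tree_deriv:
  assumes "f \<in> little_lipschitz"
  shows "bdd_above (range (\<lambda>v. norm (tree_deriv f v)))"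
proof -
  obtain n where n: "\<And>v. depth v \<ge> n \<Longrightarrow> norm (tree_deriv f v) < 1"
    using assms[unfolded little_lipschitz_iff, rule_format, of 1] by auto
  let ?A = "(\<lambda>v. norm (tree_deriv f v)) ` {v. depth v \<le> n}"
  have "finite ?A" using finite_depth_le by simp
  then have "bdd_above (?A \<union> {..1})" by (simp add: bdd_above_finite)
  moreover have "norm (tree_deriv f v) \<in> ?A \<union> {..1}" for v
    using n[of v] by (cases "depth v \<le> n") simp_all
  then have "range (\<lambda>v. norm (tree_deriv f v)) \<subseteq> ?A \<union> {..1}"
    by blast
  ultimately show ?thesis by (rule bdd_above_mono)
qed

lemma tree_deriv_backward_shift:
  assumes "homogeneous \<gamma>" "v \<noteq> root"
  shows "tree_deriv (backward_shift f) v =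
    (\<Sum>w\<in>children v. tree_deriv f w) + of_nat \<gamma> * tree_deriv f v
      - (\<Sum>w\<in>children (parent v). tree_deriv f w)"
proof -
  have "(\<Sum>w\<in>children u. tree_deriv f w) = backward_shift f u - of_nat \<gamma> * f u" for u
  proof -
    have "(\<Sum>w\<in>children u. tree_deriv f w) = (\<Sum>w\<in>children u. f w - f u)"
      by (rule sum.cong) (auto simp: tree_deriv_def children_def)
    then show ?thesis
      using assms(1) by (simp add: sum_subtractf backward_shift_def homogeneous_def)
  qed
  then show ?thesis using assms(2) by (simp add: tree_deriv_def algebra_simps)
qed

lemma tree_deriv_backward_shift_le:
  assumes "homogeneous \<gamma>" "v \<noteq> root"
    and e: "\<And>w. depth w \<ge> depth v \<Longrightarrow> norm (tree_deriv f w) \<le> e"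
  shows "norm (tree_deriv (backward_shift f) v) \<le> 3 * real \<gamma> * e"
proof -
  have sum_le: "norm (\<Sum>w\<in>children u. tree_deriv f w) \<le> real \<gamma> * e"
    if "Suc (depth u) \<ge> depth v" for u
  proof -
    have "norm (tree_deriv f w) \<le> e" if "w \<in> children u" for w
      using that \<open>Suc (depth u) \<ge> depth v\<close> depth_parent[of w]
      by (intro e) (auto simp: children_def)
    from sum_norm_le[of "children u", OF this] show ?thesis
      using assms(1) by (simp add: homogeneous_def)
  qed
  have "norm (of_nat \<gamma> * tree_deriv f v) \<le> real \<gamma> * e"
    using e[of v] by (simp add: norm_mult mult_left_mono)
  moreover have "norm (\<Sum>w\<in>children v. tree_deriv f w) \<le> real \<gamma> * e"
    by (rule sum_le) simp
  moreover have "norm (\<Sum>w\<in>children (parent v). tree_deriv f w) \<le> real \<gamma> * e"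
    by (rule sum_le) (use depth_parent[OF assms(2)] in simp)
  ultimately have "norm (\<Sum>w\<in>children v. tree_deriv f w) + norm (of_nat \<gamma> * tree_deriv f v)
      + norm (\<Sum>w\<in>children (parent v). tree_deriv f w) \<le> 3 * real \<gamma> * e"
    by linarith
  moreover have "norm (a + b - c) \<le> norm a + norm b + norm c" for a b c :: complex
    using norm_triangle_ineq4[of "a + b" c] norm_triangle_ineq[of a b] by linarith
  ultimately show ?thesis
    unfolding tree_deriv_backward_shift[OF assms(1,2)] by (rule order_trans[rotated])
qed

lemma backward_shift_little_lipschitz:
  assumes "homogeneous \<gamma>" "f \<in> little_lipschitz"
  shows "backward_shift f \<in> little_lipschitz"
  unfolding little_lipschitz_iff
proof (intro allI impI)
  fix e :: real assume "e > 0"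
  define d where "d = e / (3 * real \<gamma> + 1)"
  have "d > 0" using \<open>e > 0\<close> by (simp add: d_def add_nonneg_pos)
  then obtain n where n: "\<And>v. depth v \<ge> n \<Longrightarrow> norm (tree_deriv f v) < d"
    using assms(2) unfolding little_lipschitz_iff by blast
  have "3 * real \<gamma> * d < (3 * real \<gamma> + 1) * d" using \<open>d > 0\<close> by (simp add: algebra_simps)
  also have "\<dots> = e" by (simp add: d_def add_nonneg_pos less_imp_neq[symmetric])
  finally have de: "3 * real \<gamma> * d < e" .
  have "norm (tree_deriv (backward_shift f) v) < e"
    if "depth v \<ge> n + Suc (depth root)" for v
  proof -
    have "v \<noteq> root" using that by auto
    then have "norm (tree_deriv (backward_shift f) v) \<le> 3 * real \<gamma> * d"
      using that by (intro tree_deriv_backward_shift_le assms(1) less_imp_le n) simp_all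
    then show ?thesis using de by simp
  qed
  then show "\<exists>n. \<forall>v. depth v \<ge> n \<longrightarrow> norm (tree_deriv (backward_shift f) v) < e"
    by (intro exI[of _ "n + Suc (depth root)"]) simp
qed

lemma backward_shift_bounded:
  assumes "homogeneous \<gamma>" "f \<in> little_lipschitz"
  shows "lipschitz_norm (backward_shift f) \<le> 3 * real \<gamma> * lipschitz_norm f"
  unfolding lipschitz_norm_def[of "backward_shift f"]
proof (rule cSUP_least)
  fix v
  have le: "norm (tree_deriv f w) \<le> lipschitz_norm f" for w
    unfolding lipschitz_norm_def 
    using cSUP_upper[OF _ bdd_above_tree_deriv[OF assms(2)], of w] by simp
  show "norm (tree_deriv (backward_shift f) v) \<le> 3 * real \<gamma> * lipschitz_norm f"
  proof (cases "v = root")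
    case False
    show ?thesis by (rule tree_deriv_backward_shift_le[OF assms(1) False le])
  next
    case True
    have "norm (f w) \<le> 2 * lipschitz_norm f" if "w \<in> children root" for w
    proof -
      have "f w = tree_deriv f w + tree_deriv f root"
        using that by (simp add: tree_deriv_def children_def)
      then show ?thesis
        using le[of w] le[of root] norm_triangle_ineq[of "tree_deriv f w" "tree_deriv f root"]
        by simp
    qed
    from sum_norm_le[of "children root", OF this]
    have "norm (tree_deriv (backward_shift f) v) \<le> real \<gamma> * (2 * lipschitz_norm f)"
      using assms(1) True by (simp add: tree_deriv_def backward_shift_def homogeneous_def)
    also have "\<dots> \<le> real \<gamma> * (3 * lipschitz_norm f)"
      using order_trans[OF norm_ge_zero le[of root]] by (intro mult_left_mono) simp_all
    finally show ?thesis by simp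
  qed
qed simp

end

end

text \<open>The set of eigenvalues of an operator \<open>A\<close> acting on the space \<open>X\<close> of functions.\<close>

definition point_spectrum ::
    "('a \<Rightarrow> complex) set \<Rightarrow> (('a \<Rightarrow> complex) \<Rightarrow> 'a \<Rightarrow> complex) \<Rightarrow> complex set" where
  "point_spectrum X A = {z. \<exists>f\<in>X. f \<noteq> (\<lambda>_. 0) \<and> A f = (\<lambda>v. z * f v)}"

end

theory Submission
  imports Defs
begin

text \<open>
  Every \<open>z\<close> with \<open>norm z < \<gamma>\<close>, and also \<open>z = \<gamma>\<close>, has a radial eigenfunction: with
  \<open>\<mu> = z / \<gamma>\<close>, the function \<open>v \<mapsto> \<mu> ^ depth v\<close> is multiplied by \<open>\<gamma> * \<mu> = z\<close> under the backward
  shift, and away from the root its derivative is \<open>(\<mu> - 1) * \<mu> ^ (depth v - 1)\<close>, which tends to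
  zero if \<open>norm \<mu> < 1\<close> and vanishes if \<open>\<mu> = 1\<close>.

  Conversely, let \<open>f\<close> be an eigenfunction for \<open>z \<noteq> \<gamma>\<close>. Summing the derivative of \<open>f\<close> over the
  children of \<open>v\<close> gives \<open>(z - \<gamma>) * f v\<close>. Each such sum has \<open>\<gamma>\<close> terms, all of which are small when
  \<open>v\<close> is deep, so not only the derivative of \<open>f\<close> but \<open>f\<close> itself tends to zero. If moreover
  \<open>norm z \<ge> \<gamma>\<close>, then \<open>z * f v\<close> being the sum of the \<open>\<gamma>\<close> values of \<open>f\<close> at the children of \<open>v\<close>
  forces some child to carry a value at least as large as \<open>f v\<close> in modulus. Descending
  from child to child, the modulus never decreases, so a function that tends to zero must be zero
  everywhere. These two facts are \<open>eigenfunction_tendsto_0\<close> and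
  \<open>vanishing_eigenfunction_eq_0\<close>.
\<close>

context tree
begin

context
  fixes root :: 'v
begin

lemma depth_root: "depth root root = 0"
proof -
  have "root_path root root = [root]"
    by (rule root_path_eqI) (simp add: is_path_def)
  then show ?thesis by (simp add: depth_def)
qed

lemma depth_child: "w \<in> children root v \<Longrightarrow> depth root w = Suc (depth root v)"
  using depth_parent[of w root] by (simp add: children_def)

lemma homogeneous_order_pos:
  assumes "homogeneous root \<gamma>"
  shows "\<gamma> > 0"
proof (rule ccontr)
  assume "\<not> \<gamma> > 0"
  then have "children root v = {}" for v
    using assms finite_children[of root v] by (simp add: homogeneous_def flip: card_0_eq)
  then have "UNIV \<subseteq> {root}"
    unfolding children_def by blast
  then show False
    using infinite_vertices finite_subset by blast
qed

lemma sum_tree_deriv_children: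
  assumes "homogeneous root \<gamma>"
  shows "(\<Sum>w\<in>children root v. tree_deriv root f w) = backward_shift root f v - of_nat \<gamma> * f v"
proof -
  have "(\<Sum>w\<in>children root v. tree_deriv root f w) = (\<Sum>w\<in>children root v. f w - f v)"
    by (rule sum.cong) (auto simp: tree_deriv_def children_def)
  then show ?thesis
    using assms by (simp add: sum_subtractf backward_shift_def homogeneous_def)
qed

lemma backward_shift_radial:
  assumes "homogeneous root \<gamma>"
  shows "backward_shift root (\<lambda>v. \<mu> ^ depth root v) v = of_nat \<gamma> * \<mu> * \<mu> ^ depth root v"
  using assms by (simp add: backward_shift_def depth_child homogeneous_def)

lemma radial_in_little_lipschitz:
  assumes "norm \<mu> < 1 \<or> \<mu> = 1"
  shows "(\<lambda>v. \<mu> ^ depth root v) \<in> little_lipschitz root"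
proof -
  let ?F = "filtercomap (depth root) at_top"
  have seq: "(\<lambda>n. (\<mu> - 1) * \<mu> ^ (n - 1)) \<longlonglongrightarrow> 0"
  proof (cases "\<mu> = 1")
    case False
    then have "(\<lambda>n. (\<mu> - 1) * \<mu> ^ n) \<longlonglongrightarrow> 0"
      using assms by (intro tendsto_mult_right_zero LIMSEQ_power_zero) simp
    then show ?thesis
      by (subst filterlim_sequentially_Suc[symmetric]) simp
  qed simp
  have "((\<lambda>v. (\<mu> - 1) * \<mu> ^ (depth root v - 1)) \<longlongrightarrow> 0) ?F"
    by (rule filterlim_compose[OF seq filterlim_filtercomap])
  moreover have "(\<mu> - 1) * \<mu> ^ (depth root v - 1) = tree_deriv root (\<lambda>v. \<mu> ^ depth root v) v"
    if "depth root v \<ge> 1" for v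
  proof -
    have "v \<noteq> root" using that depth_root by auto
    then show ?thesis
      using depth_parent[of v root] by (simp add: tree_deriv_def algebra_simps)
  qed
  then have "\<forall>\<^sub>F v in ?F. (\<mu> - 1) * \<mu> ^ (depth root v - 1)
      = tree_deriv root (\<lambda>v. \<mu> ^ depth root v) v"
    unfolding eventually_filtercomap_at_top_linorder by blast
  ultimately show ?thesis
    unfolding little_lipschitz_def by (simp add: Lim_transform_eventually)
qed

text \<open>An eigenfunction is the sum of its derivative over the children, up to the factor
  \<open>z - \<gamma>\<close>; this sum has boundedly many terms, each of which is small deep in the tree.\<close>

lemma eigenfunction_tendsto_0:
  assumes hom: "homogeneous root \<gamma>" and f: "f \<in> little_lipschitz root"
    and eig: "backward_shift root f = (\<lambda>v. z * f v)" and z: "z \<noteq> of_nat \<gamma>"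
  shows "(f \<longlongrightarrow> 0) (filtercomap (depth root) at_top)"
  unfolding tendsto_iff
proof (intro allI impI)
  fix e :: real assume "e > 0"
  have pos: "real \<gamma> > 0" "norm (z - of_nat \<gamma>) > 0"
    using homogeneous_order_pos[OF hom] z by auto
  define d where "d = norm (z - of_nat \<gamma>) * (e / 2) / real \<gamma>"
  have "d > 0" using \<open>e > 0\<close> pos by (simp add: d_def)
  then obtain n where n: "\<And>v. depth root v \<ge> n \<Longrightarrow> norm (tree_deriv root f v) < d"
    using f unfolding little_lipschitz_iff by blast
  have "norm (f v) < e" if "depth root v \<ge> n" for v
  proof -
    have "norm (z - of_nat \<gamma>) * norm (f v) = norm (\<Sum>w\<in>children root v. tree_deriv root f w)"
      by (simp add: sum_tree_deriv_children[OF hom] eig flip: norm_mult left_diff_distrib)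
    also have "\<dots> \<le> (\<Sum>w\<in>children root v. d)"
      by (rule sum_norm_le, rule less_imp_le, rule n) (use that depth_child in simp)
    also have "\<dots> = norm (z - of_nat \<gamma>) * (e / 2)"
      using hom pos(1) by (simp add: homogeneous_def d_def)
    finally show ?thesis using pos(2) \<open>e > 0\<close> by simp
  qed
  then show "\<forall>\<^sub>F v in filtercomap (depth root) at_top. dist (f v) 0 < e"
    unfolding eventually_filtercomap_at_top_linorder by auto
qed

text \<open>The pigeonhole principle: if all \<open>\<gamma>\<close> children had values of modulus below that of \<open>f v\<close>,
  their sum could not reach the modulus of \<open>z * f v\<close>.\<close>

lemma eigenfunction_child_norm_ge:
  assumes hom: "homogeneous root \<gamma>"
    and eig: "backward_shift root f = (\<lambda>v. z * f v)" and z: "norm z \<ge> real \<gamma>"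
  shows "\<exists>w\<in>children root v. norm (f w) \<ge> norm (f v)"
proof (rule ccontr)
  assume "\<not> ?thesis"
  then have less: "norm (f w) < norm (f v)" if "w \<in> children root v" for w
    using that by force
  have ne: "children root v \<noteq> {}"
    using homogeneous_order_pos[OF hom] hom by (metis card.empty homogeneous_def less_irrefl)
  have "real \<gamma> * norm (f v) \<le> norm (z * f v)"
    using z by (simp add: norm_mult mult_right_mono)
  also have "z * f v = (\<Sum>w\<in>children root v. f w)"
    using fun_cong[OF eig, of v] by (simp add: backward_shift_def)
  also have "norm \<dots> \<le> (\<Sum>w\<in>children root v. norm (f w))"
    by (rule norm_sum)
  also have "\<dots> < (\<Sum>w\<in>children root v. norm (f v))"
    using finite_children ne less by (rule sum_strict_mono)
  also have "\<dots> = real \<gamma> * norm (f v)"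
    using hom by (simp add: homogeneous_def)
  finally show False by simp
qed

lemma vanishing_eigenfunction_eq_0:
  assumes hom: "homogeneous root \<gamma>"
    and eig: "backward_shift root f = (\<lambda>v. z * f v)" and z: "norm z \<ge> real \<gamma>"
    and lim: "(f \<longlongrightarrow> 0) (filtercomap (depth root) at_top)"
  shows "f = (\<lambda>_. 0)"
proof (rule ext, rule ccontr)
  fix u assume "f u \<noteq> 0"
  have deep: "\<exists>w. depth root w \<ge> n \<and> norm (f w) \<ge> norm (f u)" for n
  proof (induction n)
    case (Suc n)
    then obtain v where v: "depth root v \<ge> n" "norm (f v) \<ge> norm (f u)" by blast
    obtain w where "w \<in> children root v" "norm (f w) \<ge> norm (f v)"
      using eigenfunction_child_norm_ge[OF hom eig z] by blast
    with v show ?case using depth_child by (intro exI[of _ w]) simp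
  qed auto
  have "\<forall>\<^sub>F v in filtercomap (depth root) at_top. norm (f v) < norm (f u)"
    using tendstoD[OF lim, of "norm (f u)"] \<open>f u \<noteq> 0\<close> by simp
  then obtain n where "\<And>v. depth root v \<ge> n \<Longrightarrow> norm (f v) < norm (f u)"
    unfolding eventually_filtercomap_at_top_linorder by blast
  with deep[of n] show False by force
qed

end

end

theorem theorem6p4:
  fixes adj :: "'v \<Rightarrow> 'v \<Rightarrow> bool" and root :: 'v and \<gamma> :: nat
  assumes "tree adj"
    and "tree.homogeneous adj root \<gamma>"
  shows "point_spectrum (tree.little_lipschitz adj root)
             (tree.backward_shift adj root)
           = {z :: complex. norm z < real \<gamma>} \<union> {of_nat \<gamma>}"
proof -
  interpret tree adj by (rule assms(1))
  note hom = assms(2)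
  have pos: "\<gamma> > 0" by (rule homogeneous_order_pos[OF hom])
  show ?thesis
  proof (intro equalityI subsetI)
    fix z assume "z \<in> point_spectrum (little_lipschitz root) (backward_shift root)"
    then obtain f where f: "f \<in> little_lipschitz root" "f \<noteq> (\<lambda>_. 0)"
      and eig: "backward_shift root f = (\<lambda>v. z * f v)"
      unfolding point_spectrum_def by blast
    then show "z \<in> {z. norm z < real \<gamma>} \<union> {of_nat \<gamma>}"
      using vanishing_eigenfunction_eq_0[OF hom eig _ eigenfunction_tendsto_0[OF hom f(1) eig]]
      by force
  next
    fix z :: complex assume z: "z \<in> {z. norm z < real \<gamma>} \<union> {of_nat \<gamma>}"
    define \<mu> where "\<mu> = z / of_nat \<gamma>"
    let ?f = "\<lambda>v. \<mu> ^ depth root v"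
    have "norm \<mu> < 1 \<or> \<mu> = 1"
      using z pos by (auto simp: \<mu>_def norm_divide)
    then have "?f \<in> little_lipschitz root"
      by (rule radial_in_little_lipschitz)
    moreover have "backward_shift root ?f = (\<lambda>v. z * ?f v)"
      using pos by (intro ext) (simp add: backward_shift_radial[OF hom] \<mu>_def)
    \<comment> \<open>For \<open>z = 0\<close> the function is the indicator of the root, since \<open>0 ^ 0 = 1\<close>.\<close>
    moreover have "?f root = 1"
      by (simp add: depth_root)
    then have "?f \<noteq> (\<lambda>_. 0)"
      by (metis zero_neq_one)
    ultimately show "z \<in> point_spectrum (little_lipschitz root) (backward_shift root)"
      unfolding point_spectrum_def by blast
  qed
qed

end
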